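(* Let $G$ be the characteristic function of the one-step increment over the time step $\Delta t>0$, and suppose there exist $\alpha\in(0,2]$, $c_0>0$ and $R_{\rm tail}\ge0$ such that $|G(\eta)|\le\exp(-c_0\,\Delta t\,\|\eta\|_2^\alpha)$ for all $\eta\in\mathbb R^2$ with $\|\eta\|_2\ge R_{\rm tail}$. Let $\widehat G(\cdot;\theta)$ be the Gaussian-mixture characteristic function with parameters $\theta$ in the bounded parameter set $\Theta$ defined in the context. Then there exist positive constants $C_G^{(p)},c_G^{(p)}$ ($p\in\{1,2\}$) and, for each fixed finite number $N$ of mixture terms, constants $C_{\widehat G}^{(p)},c_{\widehat G}^{(p)}>0$ (uniform over all $\theta$ in the bounded parameter set with $N$ terms) such that, for any $\eta'>0$ with $\eta'\ge R_{\rm tail}$ and $p\in\{1,2\}$, $$\int_{\mathbb R^2\setminus[-\eta',\eta']^2}|G(\eta)|^p\,d\eta\le C_G^{(p)}e^{-c_G^{(p)}(\eta')^\alpha},\qquad \int_{\mathbb R^2\setminus[-\eta',\eta']^2}|\widehat G(\eta;\theta)|^p\,d\eta\le C_{\widehat G}^{(p)}e^{-c_{\widehat G}^{(p)}(\eta')^2}.$$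
   Context: $G(\eta)=\mathbb E[e^{i\eta\cdot\Delta X}]=\int_{\mathbb R^2}e^{i\eta\cdot y}g(y)\,dy$, where $g$ is the probability density on $\mathbb R^2$ of the one-step increment $\Delta X$. Fix $\overline\mu,\sigma_{\max}<\infty$, $\sigma_{\min}>0$, $0<\overline\rho<1$. For $N\in\mathbb N$, $\Theta$ (with $N$ terms) is the set of $\theta=\{(\beta_n,\mu_n^s,\mu_n^b,\sigma_n^s,\sigma_n^b,\rho_n)\}_{n=1}^N$ with $\beta_n\ge0$, $\sum_n\beta_n=1$, $|\mu_n^s|,|\mu_n^b|\le\overline\mu$, $\sigma_{\min}\le\sigma_n^s,\sigma_n^b\le\sigma_{\max}$, $|\rho_n|\le\overline\rho$. With $\mu_n=(\mu_n^s,\mu_n^b)$ and $\Sigma_n=\begin{pmatrix}(\sigma_n^s)^2&\rho_n\sigma_n^s\sigma_n^b\\ \rho_n\sigma_n^s\sigma_n^b&(\sigma_n^b)^2\end{pmatrix}$, $\widehat G(\eta;\theta)=\sum_{n=1}^N\beta_n\exp(i\eta^\top\mu_n-\frac12\eta^\top\Sigma_n\eta)$. The constants may depend on $\Delta t$, $\alpha$, $c_0$, $p$ and on the bounds defining $\Theta$, but not on $\eta'$. *)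

theory Defs
  imports "HOL-Probability.Probability"
begin

definition prob_density :: "(real^2 \<Rightarrow> real) \<Rightarrow> bool" where
  "prob_density g \<longleftrightarrow>
     g \<in> borel_measurable lborel \<and> (\<forall>y. 0 \<le> g y) \<and> integrable lborel g \<and> (\<integral>y. g y \<partial>lborel) = 1"

definition increment_cf :: "(real^2 \<Rightarrow> real) \<Rightarrow> real^2 \<Rightarrow> complex" where
  "increment_cf g \<eta> = (\<integral>y. exp (\<i> * complex_of_real (\<eta> \<bullet> y)) * complex_of_real (g y) \<partial>lborel)"

lemma prob_density_distributed:
  assumes "prob_space M" and "distributed M lborel X (\<lambda>y. ennreal (g y))"
    and "\<And>y. 0 \<le> g y" and "g \<in> borel_measurable lborel"
  shows "prob_density g"
proof -
  have 1: "(\<integral>\<^sup>+ y. ennreal (g y) \<partial>lborel) = 1"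
    using prob_space.emeasure_space_1[OF prob_space.prob_space_distr[OF assms(1)
        distributed_measurable[OF assms(2)]]]
      distributed_distr_eq_density[OF assms(2)] assms(4)
    by (simp add: emeasure_density)
  then have "integrable lborel g"
    using assms(3,4) by (intro integrableI_nonneg) auto
  moreover have "(\<integral>y. g y \<partial>lborel) = 1"
    using assms(3,4) 1 by (subst integral_eq_nn_integral) auto
  ultimately show ?thesis using assms(3,4) by (simp add: prob_density_def)
qed

lemma increment_cf_eq_expectation:
  assumes "distributed M lborel X (\<lambda>y. ennreal (g y))"
    and "\<And>y. 0 \<le> g y" and "g \<in> borel_measurable lborel"
  shows "increment_cf g \<eta> = (\<integral>\<omega>. exp (\<i> * complex_of_real (\<eta> \<bullet> X \<omega>)) \<partial>M)"
proof -
  have [measurable]: "X \<in> M \<rightarrow>\<^sub>M borel"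
    using distributed_measurable[OF assms(1)] by simp
  have [measurable]: "g \<in> borel_measurable borel" using assms(3) by simp
  have "(\<integral>\<omega>. exp (\<i> * complex_of_real (\<eta> \<bullet> X \<omega>)) \<partial>M)
      = (\<integral>y. exp (\<i> * complex_of_real (\<eta> \<bullet> y)) \<partial>distr M lborel X)"
    by (subst integral_distr) (auto simp: distributed_measurable[OF assms(1)])
  also have "\<dots> = (\<integral>y. exp (\<i> * complex_of_real (\<eta> \<bullet> y)) \<partial>density lborel (\<lambda>y. ennreal (g y)))"
    by (simp add: distributed_distr_eq_density[OF assms(1)])
  also have "\<dots> = increment_cf g \<eta>"
    unfolding increment_cf_def using assms(2)
    by (subst integral_density) (auto simp: scaleR_conv_of_real mult.commute)
  finally show ?thesis by simp
qed

record mixture_term =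
  weight :: real
  mean_s :: real
  mean_b :: real
  sd_s :: real
  sd_b :: real
  corr :: real

definition mean_vec :: "mixture_term \<Rightarrow> real^2" where
  "mean_vec t = vector [mean_s t, mean_b t]"

definition cov_mat :: "mixture_term \<Rightarrow> real^2^2" where
  "cov_mat t = vector
     [vector [(sd_s t)^2, corr t * sd_s t * sd_b t],
      vector [corr t * sd_s t * sd_b t, (sd_b t)^2]]"

text \<open>
  A parameter with \<open>N\<close> terms is a function on indices of which only the values at
  \<open>1, \<dots>, N\<close> matter, here and in the mixture characteristic function.
\<close>

definition Theta :: "real \<Rightarrow> real \<Rightarrow> real \<Rightarrow> real \<Rightarrow> nat \<Rightarrow> (nat \<Rightarrow> mixture_term) set" where
  "Theta \<mu>max \<sigma>min \<sigma>max \<rho>max N =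
     {\<theta>. (\<forall>n\<in>{1..N}. 0 \<le> weight (\<theta> n)
             \<and> \<bar>mean_s (\<theta> n)\<bar> \<le> \<mu>max \<and> \<bar>mean_b (\<theta> n)\<bar> \<le> \<mu>max
             \<and> \<sigma>min \<le> sd_s (\<theta> n) \<and> sd_s (\<theta> n) \<le> \<sigma>max
             \<and> \<sigma>min \<le> sd_b (\<theta> n) \<and> sd_b (\<theta> n) \<le> \<sigma>max
             \<and> \<bar>corr (\<theta> n)\<bar> \<le> \<rho>max)
          \<and> (\<Sum>n=1..N. weight (\<theta> n)) = 1}"

definition mixture_cf :: "nat \<Rightarrow> (nat \<Rightarrow> mixture_term) \<Rightarrow> real^2 \<Rightarrow> complex" where
  "mixture_cf N \<theta> \<eta> =
     (\<Sum>n=1..N. complex_of_real (weight (\<theta> n)) *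
        exp (\<i> * complex_of_real (\<eta> \<bullet> mean_vec (\<theta> n))
             - complex_of_real (1/2 * (\<eta> \<bullet> (cov_mat (\<theta> n) *v \<eta>)))))"

definition outside_box :: "real \<Rightarrow> (real^2) set" where
  "outside_box r = UNIV - {\<eta>. \<forall>i. \<eta> $ i \<in> {-r..r}}"

text \<open>
  Integrability is required explicitly because the Bochner integral of a non-integrable
  function is \<open>0\<close>.
\<close>

definition tail_integral_le :: "(real^2 \<Rightarrow> complex) \<Rightarrow> nat \<Rightarrow> real \<Rightarrow> real \<Rightarrow> bool" where
  "tail_integral_le F p r B \<longleftrightarrow>
     set_integrable lborel (outside_box r) (\<lambda>\<eta>. norm (F \<eta>) ^ p) \<and>
     set_lebesgue_integral lborel (outside_box r) (\<lambda>\<eta>. norm (F \<eta>) ^ p) \<le> B"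

end

theory Submission
  imports Defs "HOL-Real_Asymp.Real_Asymp"
begin

text \<open>
  Outside the box one has \<open>norm \<eta> > r\<close>, so half of the exponent in \<open>exp (- a * norm \<eta> powr \<alpha>)\<close>
  produces the decay in \<open>r\<close> and the other half is integrable over the plane. The mixture satisfies
  such a bound with \<open>\<alpha> = 2\<close> because the covariance matrices are uniformly positive definite, with
  smallest eigenvalue at least \<open>(1 - \<rho>max) * \<sigma>min^2\<close>. Since \<open>exp (- a * norm \<eta> powr \<alpha>) \<le> 1\<close>, the
  case \<open>p = 1\<close> implies the others, and no constant depends on \<open>p\<close> or \<open>N\<close>.
\<close>

text \<open>The exponential beats every polynomial, so the product tends to 0. This holds for every
  \<open>\<alpha> > 0\<close>, however small, and reduces integrability to that of a rational
  function.\<close>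

lemma powr_exp_decay_bound:
  fixes a \<alpha> :: real
  assumes "0 < a" "0 < \<alpha>"
  obtains K where "0 < K" "\<And>s. 0 \<le> s \<Longrightarrow> exp (- a * s powr \<alpha>) * (1 + s^2) ^ n \<le> K"
proof -
  have "((\<lambda>s::real. exp (- a * s powr \<alpha>) * (1 + s^2) ^ n) \<longlongrightarrow> 0) at_top"
    using assms by real_asymp
  then have "eventually (\<lambda>s. exp (- a * s powr \<alpha>) * (1 + s^2) ^ n < 1) at_top"
    by (rule order_tendstoD) simp
  then obtain S where S: "\<And>s. S \<le> s \<Longrightarrow> exp (- a * s powr \<alpha>) * (1 + s^2) ^ n < 1"
    by (auto simp: eventually_at_top_linorder)
  \<comment> \<open>One constant serves both ranges: it is at least 1, which covers
    \<open>s \<ge> S\<close>, and it dominates the polynomial factor for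
    \<open>0 \<le> s < S\<close>.\<close>
  have "exp (- a * s powr \<alpha>) * (1 + s^2) ^ n \<le> (1 + S^2) ^ n" if "0 \<le> s" for s
  proof (cases "S \<le> s")
    case True
    have "1 \<le> (1 + S^2) ^ n" by (rule one_le_power) simp
    then show ?thesis using S[OF True] by linarith
  next
    case False
    then have "s^2 \<le> S^2" using that by (intro power_mono) auto
    then have "(1 + s^2) ^ n \<le> (1 + S^2) ^ n" by (intro power_mono) auto
    moreover have "exp (- a * s powr \<alpha>) \<le> 1" using assms by simp
    ultimately show ?thesis
      using mult_mono[of "exp (- a * s powr \<alpha>)" 1 "(1 + s^2) ^ n" "(1 + S^2) ^ n"] by simp
  qed
  moreover have "0 < (1 + S^2) ^ n" by (intro zero_less_power add_pos_nonneg) auto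
  ultimately show ?thesis using that by blast
qed

text \<open>By Tonelli the integral splits into one-dimensional Cauchy integrals, one per
  coordinate, so no polar coordinates are needed.\<close>

lemma integrable_prod_inverse_1_plus_square:
  "integrable lborel (\<lambda>x::'a::euclidean_space. \<Prod>b\<in>Basis. inverse (1 + (x \<bullet> b)^2))"
proof (rule integrableI_nonneg)
  have "integrable lborel (\<lambda>t::real. inverse (1 + t^2))"
    using integrable_inverse_1_plus_square
    by (simp add: set_integrable_def einterval_def)
  then have "(\<integral>\<^sup>+t. ennreal (inverse (1 + t^2)) \<partial>lborel) < \<infinity>"
    by (auto simp: integrable_iff_bounded abs_of_nonneg)
  then have "(\<Prod>b\<in>(Basis::'a set). \<integral>\<^sup>+t. ennreal (inverse (1 + t^2)) \<partial>lborel) < \<infinity>"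
    by (simp add: power_less_top_ennreal)
  then show "(\<integral>\<^sup>+x. ennreal (\<Prod>b\<in>Basis. inverse (1 + ((x::'a) \<bullet> b)^2)) \<partial>lborel) < \<infinity>"
    by (simp add: prod_ennreal[symmetric]
        nn_integral_lborel_prod[where f = "\<lambda>_ t. ennreal (inverse (1 + t^2))"])
qed (auto intro!: prod_nonneg)

text \<open>The product of Cauchy kernels is a majorant: every coordinate is at most the norm, so
  its reciprocal is at most \<open>(1 + (norm x)^2) ^ DIM('a)\<close>, which the exponential absorbs
  up to the factor \<open>K\<close>.\<close>

lemma integrable_exp_norm_powr:
  fixes a \<alpha> :: real
  assumes "0 < a" "0 < \<alpha>"
  shows "integrable lborel (\<lambda>x::'a::euclidean_space. exp (- a * norm x powr \<alpha>))"
proof -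
  obtain K where K: "0 < K"
    "\<And>s. 0 \<le> s \<Longrightarrow> exp (- a * s powr \<alpha>) * (1 + s^2) ^ DIM('a) \<le> K"
    using powr_exp_decay_bound[OF assms] by blast
  show ?thesis
  proof (rule Bochner_Integration.integrable_bound)
    show "integrable lborel (\<lambda>x::'a. K * (\<Prod>b\<in>Basis. inverse (1 + (x \<bullet> b)^2)))"
      by (intro integrable_mult_right integrable_prod_inverse_1_plus_square)
    have "exp (- a * norm x powr \<alpha>) \<le> K * (\<Prod>b\<in>Basis. inverse (1 + (x \<bullet> b)^2))" for x :: 'a
    proof -
      let ?P = "\<Prod>b\<in>Basis. 1 + (x \<bullet> b)^2"
      have pos: "0 < ?P" by (intro prod_pos) (auto intro: add_pos_nonneg)
      have "?P \<le> (\<Prod>b\<in>(Basis::'a set). 1 + (norm x)^2)"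
      proof (intro prod_mono conjI)
        fix b :: 'a assume "b \<in> Basis"
        then show "1 + (x \<bullet> b)^2 \<le> 1 + (norm x)^2"
          using Basis_le_norm[of b x] by (simp add: abs_le_square_iff[symmetric])
      qed auto
      then have "exp (- a * norm x powr \<alpha>) * ?P \<le> K"
        using K(2)[of "norm x"] by (auto intro: order_trans[OF mult_left_mono])
      then have "exp (- a * norm x powr \<alpha>) \<le> K * inverse ?P"
        using pos by (simp add: field_simps)
      then show ?thesis by (simp add: prod_inversef[symmetric] o_def)
    qed
    then have "norm (exp (- a * norm x powr \<alpha>))
        \<le> norm (K * (\<Prod>b\<in>Basis. inverse (1 + (x \<bullet> b)^2)))" for x :: 'a
      by (metis abs_exp_cancel abs_ge_self order_trans real_norm_def)
    then show "AE x::'a in lborel. norm (exp (- a * norm x powr \<alpha>))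
        \<le> norm (K * (\<Prod>b\<in>Basis. inverse (1 + (x \<bullet> b)^2)))"
      by (rule AE_I2)
  qed measurable
qed

text \<open>The integral is that of the half of the exponent not spent on decay in \<open>r\<close>.
  The summand 1 gives positivity from mere nonnegativity of the integral.\<close>

definition tail_const :: "real \<Rightarrow> real \<Rightarrow> real" where
  "tail_const a \<alpha> = 1 + (\<integral>\<eta>. exp (- (a/2) * norm (\<eta> :: real^2) powr \<alpha>) \<partial>lborel)"

lemma tail_const_pos: "0 < tail_const a \<alpha>"
  unfolding tail_const_def by (intro add_pos_nonneg integral_nonneg_AE) auto

lemma norm_gt_if_outside_box:
  assumes "\<eta> \<in> outside_box r"
  shows "r < norm \<eta>"
proof -
  obtain i where "\<not> (- r \<le> \<eta> $ i \<and> \<eta> $ i \<le> r)"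
    using assms by (auto simp: outside_box_def)
  then show ?thesis using component_le_norm_cart[of \<eta> i] by linarith
qed

lemma outside_box_borel [measurable]: "outside_box r \<in> sets borel"
  unfolding outside_box_def by measurable

text \<open>Shared by both characteristic functions. The bound on \<open>F\<close> is asked for only
  from radius \<open>r\<close> on, since points outside the box have norm above
  \<open>r\<close>.\<close>

lemma tail_integral_le_of_exp_powr_bound:
  fixes a \<alpha> :: real
  assumes [measurable]: "F \<in> borel_measurable borel"
    and a: "0 < a" and \<alpha>: "0 < \<alpha>" and r: "0 < r" and p: "1 \<le> p"
    and bd: "\<And>\<eta>. r \<le> norm \<eta> \<Longrightarrow> norm (F \<eta>) \<le> exp (- a * norm \<eta> powr \<alpha>)"
  shows "tail_integral_le F p r (tail_const a \<alpha> * exp (- (a/2) * r powr \<alpha>))"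
proof -
  let ?f = "\<lambda>\<eta>. indicator (outside_box r) \<eta> *\<^sub>R norm (F \<eta>) ^ p"
  let ?h = "\<lambda>\<eta>::real^2. exp (- (a/2) * r powr \<alpha>) * exp (- (a/2) * norm \<eta> powr \<alpha>)"
  have le: "?f \<eta> \<le> ?h \<eta>" for \<eta>
  proof (cases "\<eta> \<in> outside_box r")
    case True
    then have n: "r < norm \<eta>" by (rule norm_gt_if_outside_box)
    have F: "norm (F \<eta>) \<le> exp (- a * norm \<eta> powr \<alpha>)" using n bd[of \<eta>] by simp
    \<comment> \<open>Values of modulus at most 1 do not grow under a power
      \<open>p \<ge> 1\<close>; this removes \<open>p\<close> from the estimate.\<close>
    moreover have "exp (- a * norm \<eta> powr \<alpha>) \<le> 1" using a by simp
    ultimately have "norm (F \<eta>) \<le> 1" by linarith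
    then have "norm (F \<eta>) ^ p \<le> norm (F \<eta>)"
      using power_decreasing[OF p, of "norm (F \<eta>)"] by simp
    also note F
    also have "exp (- a * norm \<eta> powr \<alpha>) \<le> ?h \<eta>"
    proof -
      \<comment> \<open>Only one of the two halves of the exponent is weakened from
        \<open>norm \<eta>\<close> to \<open>r\<close>.\<close>
      have "a * r powr \<alpha> \<le> a * norm \<eta> powr \<alpha>"
        using a \<alpha> r n by (intro mult_left_mono powr_mono2) auto
      then show ?thesis by (simp add: exp_add[symmetric])
    qed
    finally show ?thesis using True by simp
  qed simp
  have h: "integrable lborel ?h"
    using a \<alpha> by (intro integrable_mult_right integrable_exp_norm_powr) auto
  have f: "integrable lborel ?f"
  proof (rule Bochner_Integration.integrable_bound[OF h])
    have "norm (?f \<eta>) \<le> norm (?h \<eta>)" for \<eta>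
    proof -
      have "norm (?f \<eta>) = ?f \<eta>" by simp
      also note le
      also have "?h \<eta> \<le> norm (?h \<eta>)" by (simp only: real_norm_def abs_ge_self)
      finally show ?thesis .
    qed
    then show "AE \<eta> in lborel. norm (?f \<eta>) \<le> norm (?h \<eta>)" by (rule AE_I2)
  qed measurable
  have "integral\<^sup>L lborel ?f \<le> integral\<^sup>L lborel ?h"
    using f h le by (rule integral_mono)
  also have "\<dots> = exp (- (a/2) * r powr \<alpha>) * (tail_const a \<alpha> - 1)"
    by (simp add: tail_const_def)
  also have "\<dots> \<le> tail_const a \<alpha> * exp (- (a/2) * r powr \<alpha>)"
    by (simp add: algebra_simps)
  finally show ?thesis
    using f by (simp add: tail_integral_le_def set_integrable_def set_lebesgue_integral_def)
qed

lemma increment_cf_borel_measurable: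
  assumes "prob_density g"
  shows "increment_cf g \<in> borel_measurable borel"
proof -
  have [measurable]: "g \<in> borel_measurable borel" using assms by (simp add: prob_density_def)
  show ?thesis unfolding increment_cf_def by measurable
qed

lemma mixture_cf_borel_measurable: "mixture_cf N \<theta> \<in> borel_measurable borel"
  unfolding mixture_cf_def
  by (intro borel_measurable_continuous_onI continuous_intros
      matrix_vector_mult_linear_continuous_on)

text \<open>In the scaled coordinates \<open>sd_s t * \<eta>$1\<close> and
  \<open>sd_b t * \<eta>$2\<close> only the correlation matrix remains.\<close>

lemma cov_mat_quadratic_form:
  "\<eta> \<bullet> (cov_mat t *v \<eta>) = (sd_s t * \<eta>$1)^2 + 2 * corr t * (sd_s t * \<eta>$1) * (sd_b t * \<eta>$2)
     + (sd_b t * \<eta>$2)^2"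
  by (simp add: cov_mat_def inner_vec_def matrix_vector_mult_def sum_2 power2_eq_square algebra_simps)

text \<open>The correlation matrix has eigenvalues \<open>1 + \<rho>\<close> and
  \<open>1 - \<rho>\<close>, both at least \<open>1 - \<rho>max\<close>; the elementary form of this
  is \<open>2 * \<bar>u * v\<bar> \<le> u^2 + v^2\<close>.\<close>

lemma correlated_form_lower_bound:
  fixes u v \<rho> \<rho>max :: real
  assumes "\<bar>\<rho>\<bar> \<le> \<rho>max"
  shows "(1 - \<rho>max) * (u^2 + v^2) \<le> u^2 + 2 * \<rho> * u * v + v^2"
proof -
  have "0 \<le> (\<bar>u\<bar> - \<bar>v\<bar>)^2" by simp
  then have uv: "2 * (\<bar>u\<bar> * \<bar>v\<bar>) \<le> u^2 + v^2" by (simp add: power2_diff)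
  have "- (2 * \<rho> * u * v) \<le> \<bar>\<rho>\<bar> * (2 * (\<bar>u\<bar> * \<bar>v\<bar>))"
    using abs_ge_minus_self[of "2 * \<rho> * u * v"] by (simp add: abs_mult mult_ac)
  also have "\<dots> \<le> \<rho>max * (u^2 + v^2)" using assms uv by (intro mult_mono) auto
  finally show ?thesis by (simp add: algebra_simps)
qed

lemma cov_mat_coercive:
  assumes "0 < \<sigma>min" "\<rho>max < 1" "\<sigma>min \<le> sd_s t" "\<sigma>min \<le> sd_b t" "\<bar>corr t\<bar> \<le> \<rho>max"
  shows "(1 - \<rho>max) * \<sigma>min^2 * (norm \<eta>)^2 \<le> \<eta> \<bullet> (cov_mat t *v \<eta>)"
proof -
  have "\<sigma>min^2 \<le> (sd_s t)^2" "\<sigma>min^2 \<le> (sd_b t)^2" using assms by (auto intro: power_mono)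
  then have "\<sigma>min^2 * (\<eta>$1)^2 + \<sigma>min^2 * (\<eta>$2)^2 \<le> (sd_s t * \<eta>$1)^2 + (sd_b t * \<eta>$2)^2"
    unfolding power_mult_distrib by (intro add_mono mult_right_mono) auto
  moreover have "(norm \<eta>)^2 = (\<eta>$1)^2 + (\<eta>$2)^2"
    by (simp add: power2_norm_eq_inner inner_vec_def sum_2) (simp add: power2_eq_square)
  ultimately have "(1 - \<rho>max) * (\<sigma>min^2 * (norm \<eta>)^2)
      \<le> (1 - \<rho>max) * ((sd_s t * \<eta>$1)^2 + (sd_b t * \<eta>$2)^2)"
    using assms(2) by (intro mult_left_mono) (simp_all add: distrib_left)
  also have "\<dots> \<le> \<eta> \<bullet> (cov_mat t *v \<eta>)"
    unfolding cov_mat_quadratic_form using assms by (intro correlated_form_lower_bound) auto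
  finally show ?thesis by (simp add: mult.assoc)
qed

text \<open>The means contribute only phases of modulus 1, each term is bounded by the same
  Gaussian, and the weights sum to 1, so the bound is uniform in \<open>\<theta>\<close> and
  \<open>N\<close>.\<close>

lemma norm_mixture_cf_le:
  assumes "0 < \<sigma>min" "\<rho>max < 1" and \<theta>: "\<theta> \<in> Theta \<mu>max \<sigma>min \<sigma>max \<rho>max N"
  shows "norm (mixture_cf N \<theta> \<eta>) \<le> exp (- ((1 - \<rho>max) * \<sigma>min^2 / 2) * (norm \<eta>)^2)"
    (is "_ \<le> ?E")
proof -
  have "norm (mixture_cf N \<theta> \<eta>) \<le> (\<Sum>n=1..N. weight (\<theta> n) * ?E)"
    unfolding mixture_cf_def
  proof (rule sum_norm_le)
    fix n assume n: "n \<in> {1..N}"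
    have "(1 - \<rho>max) * \<sigma>min^2 * (norm \<eta>)^2 \<le> \<eta> \<bullet> (cov_mat (\<theta> n) *v \<eta>)"
      using \<theta> n assms(1,2) by (intro cov_mat_coercive) (auto simp: Theta_def)
    moreover have "0 \<le> weight (\<theta> n)" using \<theta> n by (auto simp: Theta_def)
    ultimately show "norm (complex_of_real (weight (\<theta> n)) *
        exp (\<i> * complex_of_real (\<eta> \<bullet> mean_vec (\<theta> n))
             - complex_of_real (1/2 * (\<eta> \<bullet> (cov_mat (\<theta> n) *v \<eta>))))) \<le> weight (\<theta> n) * ?E"
      by (auto simp: norm_mult intro!: mult_left_mono)
  qed
  also have "\<dots> = ?E" using \<theta> by (simp add: Theta_def sum_distrib_right[symmetric])
  finally show ?thesis .
qed

theorem lemma4p3: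
  fixes \<Delta>t \<alpha> c0 \<mu>max \<sigma>min \<sigma>max \<rho>max :: real
  assumes "0 < \<Delta>t" and "0 < \<alpha>" and "\<alpha> \<le> 2" and "0 < c0"
    and "0 < \<sigma>min" and "0 < \<rho>max" and "\<rho>max < 1"
  shows "\<exists>(C_G :: nat \<Rightarrow> real) (c_G :: nat \<Rightarrow> real)
            (C_hat :: nat \<Rightarrow> nat \<Rightarrow> real) (c_hat :: nat \<Rightarrow> nat \<Rightarrow> real).
     (\<forall>p\<in>{1, 2}. 0 < C_G p \<and> 0 < c_G p \<and> (\<forall>N. 0 < C_hat N p \<and> 0 < c_hat N p)) \<and>
     (\<forall>(g :: real^2 \<Rightarrow> real) (R_tail :: real).
        prob_density g \<longrightarrow> 0 \<le> R_tail \<longrightarrow>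
        (\<forall>\<eta>. R_tail \<le> norm \<eta> \<longrightarrow>
           norm (increment_cf g \<eta>) \<le> exp (- c0 * \<Delta>t * norm \<eta> powr \<alpha>)) \<longrightarrow>
        (\<forall>\<eta>' > 0. R_tail \<le> \<eta>' \<longrightarrow> (\<forall>p\<in>{1, 2}.
           tail_integral_le (increment_cf g) p \<eta>' (C_G p * exp (- c_G p * \<eta>' powr \<alpha>)) \<and>
           (\<forall>N. \<forall>\<theta>\<in>Theta \<mu>max \<sigma>min \<sigma>max \<rho>max N.
              tail_integral_le (mixture_cf N \<theta>) p \<eta>' (C_hat N p * exp (- c_hat N p * \<eta>'^2))))))"
proof -
  define a where "a = c0 * \<Delta>t"
  \<comment> \<open>The halving comes from the factor 1/2 in the Gaussian exponent; the final rate
    \<open>b/2\<close> halves once more.\<close>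
  define b where "b = (1 - \<rho>max) * \<sigma>min^2 / 2"
  have a: "0 < a" and b: "0 < b" using assms by (auto simp: a_def b_def)
  have G: "tail_integral_le (increment_cf g) p r (tail_const a \<alpha> * exp (- (a/2) * r powr \<alpha>))"
    if "prob_density g" "0 < r" "R \<le> r" "p \<in> {1, 2}"
      and "\<forall>\<eta>. R \<le> norm \<eta> \<longrightarrow> norm (increment_cf g \<eta>) \<le> exp (- c0 * \<Delta>t * norm \<eta> powr \<alpha>)"
    for g R r p
    using that a \<open>0 < \<alpha>\<close>
    by (intro tail_integral_le_of_exp_powr_bound increment_cf_borel_measurable) (auto simp: a_def)
  have G_hat: "tail_integral_le (mixture_cf N \<theta>) p r (tail_const b 2 * exp (- (b/2) * r^2))"
    if "\<theta> \<in> Theta \<mu>max \<sigma>min \<sigma>max \<rho>max N" "0 < r" "p \<in> {1, 2}" for N \<theta> r p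
  proof -
    have "tail_integral_le (mixture_cf N \<theta>) p r (tail_const b 2 * exp (- (b/2) * r powr 2))"
    proof (rule tail_integral_le_of_exp_powr_bound)
      fix \<eta> :: "real^2" assume "r \<le> norm \<eta>"
      then show "norm (mixture_cf N \<theta> \<eta>) \<le> exp (- b * norm \<eta> powr 2)"
        using norm_mixture_cf_le[OF assms(5,7) that(1), of \<eta>] by (simp add: b_def)
    qed (use that b in \<open>auto intro: mixture_cf_borel_measurable\<close>)
    then show ?thesis using that by simp
  qed
  show ?thesis
  proof (intro exI conjI ballI allI impI)
    fix p N :: nat
    \<comment> \<open>These goals instantiate the schematic witnesses, as functions constant in
      \<open>p\<close> and \<open>N\<close>; the remaining goals then match \<open>G\<close> and
      \<open>G_hat\<close>.\<close>
    show "0 < tail_const a \<alpha>" "0 < a/2" "0 < tail_const b 2" "0 < b/2"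
      using a b by (simp_all add: tail_const_pos)
  qed ((rule G; assumption), (rule G_hat; assumption))
qed

end
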